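(* Let $\lambda_2$ be the $3$-dimensional complex Leibniz algebra with basis $e_1,e_2,e_3$ and only nonzero bracket $[e_1,e_1]=e_3$. Then $\lambda_2$ has no metric Leibniz cocycles, and it does not deform (non-trivially) to a metric Leibniz algebra.
   Context: All algebras are over $\mathbb{C}$. A left (resp. right) Leibniz algebra is a vector space $\mathfrak{L}$ with a bilinear bracket satisfying $[x,[y,z]]=[[x,y],z]+[y,[x,z]]$ (resp. $[x,[y,z]]=[[x,y],z]-[[x,z],y]$); a Leibniz algebra is one or the other. A bilinear form $B$ on $\mathfrak{L}$ is invariant if $B([x,y],z)=B(x,[y,z])$ for all $x,y,z$. $\mathfrak{L}$ is metric if it has a non-degenerate symmetric invariant bilinear form. Leibniz cochains with adjoint coefficients: $CL^n(\mathfrak{L};\mathfrak{L})=\mathrm{Hom}_{\mathbb{C}}(\mathfrak{L}^{\otimes n},\mathfrak{L})$ with coboundary (right convention) $\delta^n f(x_1,\dots,x_{n+1})=[x_1,f(x_2,\dots,x_{n+1})]+\sum_{i=2}^{n+1}(-1)^i[f(x_1,\dots,\hat x_i,\dots,x_{n+1}),x_i]+\sum_{1\le i<j\le n+1}(-1)^{j+1}f(x_1,\dots,x_{i-1},[x_i,x_j],x_{i+1},\dots,\hat x_j,\dots,x_{n+1})$, and cohomology $HL^n(\mathfrak{L};\mathfrak{L})$. A formal $1$-parameter deformation of $(\mathfrak{L},\mu_0)$ is a Leibniz bracket $\mu_t=\mu_0+t\phi_1+t^2\phi_2+\cdots$ on $\mathfrak{L}\otimes\mathbb{C}[[t]]$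 with $\phi_i\in CL^2(\mathfrak{L};\mathfrak{L})$; then $\phi_1$ is a $2$-cocycle. Two deformations $\mu_t,\tilde\mu_t$ are equivalent if $\tilde\mu_t(x,y)=\Phi_t\mu_t(\Phi_t^{-1}x,\Phi_t^{-1}y)$ for some $\Phi_t=\mathrm{id}+t\,\Phi_1+t^2\Phi_2+\cdots$ with linear $\Phi_i$; a deformation equivalent to $\mu_0$ is trivial. A metric Leibniz cocycle is a $2$-cocycle $\phi$, not a coboundary, such that $\mu_0+t\phi$ is a metric Leibniz algebra for $t\neq0$. $\mathfrak{L}$ deforms to a metric Leibniz algebra if it has a non-trivial deformation $\mu_t$ that is a metric Leibniz algebra for $t\ne 0$ (for formal $t$: after extending scalars to $\mathbb{C}((t))$). *)

theory Defs
  imports "HOL-Analysis.Analysis" "HOL-Computational_Algebra.Formal_Laurent_Series"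
begin

unbundle no fps_syntax

text \<open>
  A finite-dimensional algebra is given on a free module \<open>'k ^ 'n\<close> over a commutative ring \<open>'k\<close>, with
  scalar multiplication \<open>(*s)\<close>. The same definitions then serve for \<open>\<LL>\<close> over \<open>complex\<close>, for
  \<open>\<LL> \<otimes> \<complex>[[t]]\<close> over \<open>complex fps\<close> and for \<open>\<LL> \<otimes> \<complex>((t))\<close> over \<open>complex fls\<close>.
\<close>

definition bilinear_over ::
    "('k::comm_ring_1 \<Rightarrow> 'b \<Rightarrow> 'b) \<Rightarrow> ('k ^ 'n \<Rightarrow> 'k ^ 'n \<Rightarrow> 'b::ab_group_add) \<Rightarrow> bool" where
  "bilinear_over s f \<longleftrightarrow>
     (\<forall>x. module_hom (*s) s (f x)) \<and> (\<forall>y. module_hom (*s) s (\<lambda>x. f x y))"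

definition left_leibniz :: "('a::ab_group_add \<Rightarrow> 'a \<Rightarrow> 'a) \<Rightarrow> bool" where
  "left_leibniz \<mu> \<longleftrightarrow> (\<forall>x y z. \<mu> x (\<mu> y z) = \<mu> (\<mu> x y) z + \<mu> y (\<mu> x z))"

definition right_leibniz :: "('a::ab_group_add \<Rightarrow> 'a \<Rightarrow> 'a) \<Rightarrow> bool" where
  "right_leibniz \<mu> \<longleftrightarrow> (\<forall>x y z. \<mu> x (\<mu> y z) = \<mu> (\<mu> x y) z - \<mu> (\<mu> x z) y)"

definition leibniz_algebra :: "('k::comm_ring_1 ^ 'n \<Rightarrow> 'k ^ 'n \<Rightarrow> 'k ^ 'n) \<Rightarrow> bool" where
  "leibniz_algebra \<mu> \<longleftrightarrow> bilinear_over (*s) \<mu> \<and> (left_leibniz \<mu> \<or> right_leibniz \<mu>)"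

definition invariant_form ::
    "('k::comm_ring_1 ^ 'n \<Rightarrow> 'k ^ 'n \<Rightarrow> 'k ^ 'n) \<Rightarrow> ('k ^ 'n \<Rightarrow> 'k ^ 'n \<Rightarrow> 'k) \<Rightarrow> bool" where
  "invariant_form \<mu> B \<longleftrightarrow>
     bilinear_over (*) B \<and> (\<forall>x y z. B (\<mu> x y) z = B x (\<mu> y z))"

definition metric_leibniz :: "('k::field ^ 'n \<Rightarrow> 'k ^ 'n \<Rightarrow> 'k ^ 'n) \<Rightarrow> bool" where
  "metric_leibniz \<mu> \<longleftrightarrow> leibniz_algebra \<mu> \<and>
     (\<exists>B. invariant_form \<mu> B \<and> (\<forall>x y. B x y = B y x) \<and>
          (\<forall>x. (\<forall>y. B x y = 0) \<longrightarrow> x = 0))"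

text \<open>
  An \<open>n\<close>-cochain is an \<open>n\<close>-linear map, encoded as a function on lists of which only the values on
  lists of length \<open>n\<close> matter.
\<close>

definition cochain :: "nat \<Rightarrow> (('k::comm_ring_1 ^ 'n) list \<Rightarrow> 'k ^ 'n) \<Rightarrow> bool" where
  "cochain n f \<longleftrightarrow>
     (\<forall>xs i. length xs = n \<and> i < n \<longrightarrow> module_hom (*s) (*s) (\<lambda>v. f (xs[i := v])))"

text \<open>Arguments are counted from 1, so that \<open>x\<^sub>i\<close> is \<open>arg xs i\<close>.\<close>

definition arg :: "'a list \<Rightarrow> nat \<Rightarrow> 'a" where
  "arg xs i = xs ! (i - 1)"

definition omit :: "nat \<Rightarrow> 'a list \<Rightarrow> 'a list" where
  "omit i xs = take (i - 1) xs @ drop i xs"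

text \<open>The Leibniz coboundary \<open>\<delta>\<^sup>n\<close> with adjoint coefficients, in the convention for right Leibniz
  algebras.\<close>

definition leibniz_delta ::
    "('k::comm_ring_1 ^ 'n \<Rightarrow> 'k ^ 'n \<Rightarrow> 'k ^ 'n) \<Rightarrow> nat \<Rightarrow>
     (('k ^ 'n) list \<Rightarrow> 'k ^ 'n) \<Rightarrow> ('k ^ 'n) list \<Rightarrow> 'k ^ 'n" where
  "leibniz_delta \<mu> n f xs =
     \<mu> (arg xs 1) (f (omit 1 xs))
     + (\<Sum>i = 2..n + 1. (-1) ^ i *s \<mu> (f (omit i xs)) (arg xs i))
     + (\<Sum>j = 1..n + 1. \<Sum>i = 1..<j.
          (-1) ^ (j + 1) *s f (omit j (xs[i - 1 := \<mu> (arg xs i) (arg xs j)])))"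

definition leibniz_cocycle ::
    "('k::comm_ring_1 ^ 'n \<Rightarrow> 'k ^ 'n \<Rightarrow> 'k ^ 'n) \<Rightarrow> nat \<Rightarrow> (('k ^ 'n) list \<Rightarrow> 'k ^ 'n) \<Rightarrow> bool" where
  "leibniz_cocycle \<mu> n f \<longleftrightarrow>
     cochain n f \<and> (\<forall>xs. length xs = n + 1 \<longrightarrow> leibniz_delta \<mu> n f xs = 0)"

definition leibniz_coboundary ::
    "('k::comm_ring_1 ^ 'n \<Rightarrow> 'k ^ 'n \<Rightarrow> 'k ^ 'n) \<Rightarrow> nat \<Rightarrow> (('k ^ 'n) list \<Rightarrow> 'k ^ 'n) \<Rightarrow> bool" where
  "leibniz_coboundary \<mu> n f \<longleftrightarrow>
     (\<exists>m g. n = m + 1 \<and> cochain m g \<and> (\<forall>xs. length xs = n \<longrightarrow> f xs = leibniz_delta \<mu> m g xs))"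

definition cochain2 :: "('a \<Rightarrow> 'a \<Rightarrow> 'a) \<Rightarrow> 'a list \<Rightarrow> 'a" where
  "cochain2 \<phi> xs = \<phi> (arg xs 1) (arg xs 2)"

definition metric_leibniz_cocycle ::
    "('k::field ^ 'n \<Rightarrow> 'k ^ 'n \<Rightarrow> 'k ^ 'n) \<Rightarrow> ('k ^ 'n \<Rightarrow> 'k ^ 'n \<Rightarrow> 'k ^ 'n) \<Rightarrow> bool" where
  "metric_leibniz_cocycle \<mu>\<^sub>0 \<phi> \<longleftrightarrow>
     leibniz_cocycle \<mu>\<^sub>0 2 (cochain2 \<phi>) \<and> \<not> leibniz_coboundary \<mu>\<^sub>0 2 (cochain2 \<phi>) \<and>
     (\<forall>t. t \<noteq> 0 \<longrightarrow> metric_leibniz (\<lambda>x y. \<mu>\<^sub>0 x y + t *s \<phi> x y))"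

text \<open>The (bi)linear map with prescribed values on the standard basis.\<close>

definition linear_ext :: "('n \<Rightarrow> 'k ^ 'n) \<Rightarrow> 'k ^ 'n \<Rightarrow> 'k::comm_ring_1 ^ 'n" where
  "linear_ext c x = (\<Sum>i\<in>UNIV. (x $ i) *s c i)"

definition bilinear_ext :: "('n \<Rightarrow> 'n \<Rightarrow> 'k ^ 'n) \<Rightarrow> 'k ^ 'n \<Rightarrow> 'k ^ 'n \<Rightarrow> 'k::comm_ring_1 ^ 'n" where
  "bilinear_ext c x y = (\<Sum>i\<in>UNIV. \<Sum>j\<in>UNIV. (x $ i * y $ j) *s c i j)"

text \<open>The vector \<open>v 0 + t v 1 + t\<^sup>2 v 2 + \<dots>\<close> of \<open>\<complex>[[t]]\<^sup>n\<close>.\<close>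

definition vec_series :: "(nat \<Rightarrow> complex ^ 'n) \<Rightarrow> complex fps ^ 'n" where
  "vec_series v = (\<chi> k. Abs_fps (\<lambda>m. v m $ k))"

definition vec_fps_to_fls :: "complex fps ^ 'n \<Rightarrow> complex fls ^ 'n" where
  "vec_fps_to_fls x = (\<chi> k. fps_to_fls (x $ k))"

text \<open>
  A family \<open>\<phi> 0, \<phi> 1, \<dots>\<close> of bilinear maps stands for \<open>\<mu>\<^sub>t = \<phi> 0 + t \<phi> 1 + t\<^sup>2 \<phi> 2 + \<dots>\<close>. Its extension to
  \<open>\<complex>[[t]]\<^sup>n\<close> (resp. \<open>\<complex>((t))\<^sup>n\<close>) is the bilinear map over \<open>\<complex>[[t]]\<close> (resp. \<open>\<complex>((t))\<close>) with the values
  \<open>\<mu>\<^sub>t(e\<^sub>i, e\<^sub>j)\<close> on basis vectors. Likewise for families of linear maps.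
\<close>

definition series_bracket ::
    "(nat \<Rightarrow> complex ^ 'n \<Rightarrow> complex ^ 'n \<Rightarrow> complex ^ 'n) \<Rightarrow>
     complex fps ^ 'n \<Rightarrow> complex fps ^ 'n \<Rightarrow> complex fps ^ 'n" where
  "series_bracket \<phi> = bilinear_ext (\<lambda>i j. vec_series (\<lambda>m. \<phi> m (axis i 1) (axis j 1)))"

definition laurent_bracket ::
    "(nat \<Rightarrow> complex ^ 'n \<Rightarrow> complex ^ 'n \<Rightarrow> complex ^ 'n) \<Rightarrow>
     complex fls ^ 'n \<Rightarrow> complex fls ^ 'n \<Rightarrow> complex fls ^ 'n" where
  "laurent_bracket \<phi> =
     bilinear_ext (\<lambda>i j. vec_fps_to_fls (vec_series (\<lambda>m. \<phi> m (axis i 1) (axis j 1))))"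

definition series_map ::
    "(nat \<Rightarrow> complex ^ 'n \<Rightarrow> complex ^ 'n) \<Rightarrow> complex fps ^ 'n \<Rightarrow> complex fps ^ 'n" where
  "series_map \<Phi> = linear_ext (\<lambda>i. vec_series (\<lambda>m. \<Phi> m (axis i 1)))"

definition formal_deformation ::
    "(complex ^ 'n \<Rightarrow> complex ^ 'n \<Rightarrow> complex ^ 'n) \<Rightarrow>
     (nat \<Rightarrow> complex ^ 'n \<Rightarrow> complex ^ 'n \<Rightarrow> complex ^ 'n) \<Rightarrow> bool" where
  "formal_deformation \<mu>\<^sub>0 \<phi> \<longleftrightarrow>
     \<phi> 0 = \<mu>\<^sub>0 \<and> (\<forall>m. bilinear_over (*s) (\<phi> m)) \<and> leibniz_algebra (series_bracket \<phi>)"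

text \<open>Since \<open>\<Phi> 0 = id\<close>, the map \<open>series_map \<Phi>\<close> is always bijective, so \<open>inv\<close> is its genuine inverse.\<close>

definition equivalent_deformations ::
    "(nat \<Rightarrow> complex ^ 'n \<Rightarrow> complex ^ 'n \<Rightarrow> complex ^ 'n) \<Rightarrow>
     (nat \<Rightarrow> complex ^ 'n \<Rightarrow> complex ^ 'n \<Rightarrow> complex ^ 'n) \<Rightarrow> bool" where
  "equivalent_deformations \<phi> \<psi> \<longleftrightarrow>
     (\<exists>\<Phi>. \<Phi> 0 = id \<and> (\<forall>m. module_hom (*s) (*s) (\<Phi> m)) \<and>
        (\<forall>x y. series_bracket \<psi> x y =
           series_map \<Phi> (series_bracket \<phi> (inv (series_map \<Phi>) x) (inv (series_map \<Phi>) y))))"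

definition constant_deformation ::
    "(complex ^ 'n \<Rightarrow> complex ^ 'n \<Rightarrow> complex ^ 'n) \<Rightarrow>
     nat \<Rightarrow> complex ^ 'n \<Rightarrow> complex ^ 'n \<Rightarrow> complex ^ 'n" where
  "constant_deformation \<mu>\<^sub>0 m = (if m = 0 then \<mu>\<^sub>0 else (\<lambda>x y. 0))"

definition trivial_deformation ::
    "(complex ^ 'n \<Rightarrow> complex ^ 'n \<Rightarrow> complex ^ 'n) \<Rightarrow>
     (nat \<Rightarrow> complex ^ 'n \<Rightarrow> complex ^ 'n \<Rightarrow> complex ^ 'n) \<Rightarrow> bool" where
  "trivial_deformation \<mu>\<^sub>0 \<phi> \<longleftrightarrow> equivalent_deformations (constant_deformation \<mu>\<^sub>0) \<phi>"

definition deforms_to_metric ::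
    "(complex ^ 'n \<Rightarrow> complex ^ 'n \<Rightarrow> complex ^ 'n) \<Rightarrow> bool" where
  "deforms_to_metric \<mu>\<^sub>0 \<longleftrightarrow>
     (\<exists>\<phi>. formal_deformation \<mu>\<^sub>0 \<phi> \<and> \<not> trivial_deformation \<mu>\<^sub>0 \<phi> \<and>
          metric_leibniz (laurent_bracket \<phi>))"

definition lambda2 :: "complex ^ 3 \<Rightarrow> complex ^ 3 \<Rightarrow> complex ^ 3" where
  "lambda2 = bilinear_ext (\<lambda>i j. if i = 1 \<and> j = 1 then axis 3 1 else 0)"


section \<open>Consistency checks\<close>

lemma module_vec: "module ((*s) :: 'k::comm_ring_1 \<Rightarrow> 'k ^ 'n \<Rightarrow> 'k ^ 'n)"
  by unfold_locales (simp_all add: vec_eq_iff algebra_simps)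

lemma leibniz_delta_1:
  "leibniz_delta \<mu> 1 f [x, y] = \<mu> x (f [y]) + \<mu> (f [x]) y - f [\<mu> x y]"
  by (simp add: leibniz_delta_def omit_def arg_def numeral_2_eq_2 vector_sneg_minus1[symmetric])

lemma leibniz_delta_2:
  "leibniz_delta \<mu> 2 (cochain2 \<phi>) [x, y, z] =
     \<mu> x (\<phi> y z) + \<mu> (\<phi> x z) y - \<mu> (\<phi> x y) z
     - \<phi> (\<mu> x y) z + \<phi> (\<mu> x z) y + \<phi> x (\<mu> y z)"
  by (simp add: leibniz_delta_def omit_def arg_def cochain2_def eval_nat_numeral
      atLeastLessThanSuc sum.atLeast_Suc_atMost
      vector_sneg_minus1[symmetric])

lemma lambda2_eq: "lambda2 x y = (x $ 1 * y $ 1) *s axis 3 1"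
  by (simp add: lambda2_def bilinear_ext_def sum_3 axis_def vec_eq_iff forall_3)

lemma leibniz_algebra_lambda2: "leibniz_algebra lambda2"
proof -
  have "module_hom (*s) (*s) (lambda2 x)" "module_hom (*s) (*s) (\<lambda>x. lambda2 x y)" for x y
    by (auto simp: module_hom_def module_hom_axioms_def module_vec lambda2_eq vec_eq_iff
        algebra_simps)
  then show ?thesis
    by (simp add: leibniz_algebra_def bilinear_over_def left_leibniz_def lambda2_eq
        axis_def vec_eq_iff)
qed

text \<open>\<open>\<lambda>\<^sub>2\<close> is itself metric, so the non-triviality requirement on deformations cannot be dropped.\<close>

lemma metric_leibniz_lambda2: "metric_leibniz lambda2"
proof -
  define B :: "complex ^ 3 \<Rightarrow> complex ^ 3 \<Rightarrow> complex"
    where "B = (\<lambda>x y. x $ 1 * y $ 3 + x $ 3 * y $ 1 + x $ 2 * y $ 2)"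
  have mult: "module ((*) :: complex \<Rightarrow> complex \<Rightarrow> complex)"
    by unfold_locales (simp_all add: algebra_simps)
  have "module_hom (*s) (*) (B x)" "module_hom (*s) (*) (\<lambda>x. B x y)" for x y
    by (auto simp: module_hom_def module_hom_axioms_def module_vec mult B_def algebra_simps)
  moreover have "B (lambda2 x y) z = B x (lambda2 y z)" for x y z
    by (simp add: B_def lambda2_eq axis_def)
  moreover have "x = 0" if "\<forall>y. B x y = 0" for x
  proof -
    have "B x (axis 1 1) = 0" "B x (axis 2 1) = 0" "B x (axis 3 1) = 0"
      using that by blast+
    then show ?thesis
      by (simp add: B_def axis_def vec_eq_iff forall_3)
  qed
  moreover have "B x y = B y x" for x y
    by (simp add: B_def)
  ultimately show ?thesis
    using leibniz_algebra_lambda2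
    unfolding metric_leibniz_def invariant_form_def bilinear_over_def by blast
qed

end

theory Submission
  imports Defs
begin

text \<open>
  In a metric Leibniz algebra the squares are central, so the symmetric part of the bracket takes
  values in a totally isotropic subspace. In dimension 3 that subspace is at most a line, and as soon
  as some square \<open>w = \<mu>(e, e)\<close> is nonzero, invariance forces \<open>\<mu>(x, y) = h(x) h(y) w\<close> with a linear form
  \<open>h\<close> such that \<open>h(e) = 1\<close> and \<open>h(w) = 0\<close>; the alternating part vanishes because it descends to a
  3-form on a plane. So the bracket is isomorphic to \<open>\<lambda>\<^sub>2\<close>. For \<open>\<lambda>\<^sub>2 + t \<phi>\<close> with generic \<open>t\<close>,
  comparing the coefficients of \<open>t\<close> shows that \<open>\<phi>\<close> is a coboundary. For a formal deformation, \<open>h\<close> and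
  \<open>w\<close> have coefficients in \<open>\<complex>[[t]]\<close>, and \<open>e\<^sub>1 \<mapsto> e\<^sub>1\<close>, \<open>e\<^sub>2 \<mapsto> e\<^sub>2 - h(e\<^sub>2) e\<^sub>1\<close>, \<open>e\<^sub>3 \<mapsto> w\<close> is an
  equivalence with \<open>\<lambda>\<^sub>2\<close>.
\<close>

text \<open>\<open>Formal_Laurent_Series\<close> redeclares the bundle \<open>fps_syntax\<close>, so without the qualifier \<open>$\<close> would
  stay ambiguous.\<close>

unbundle no Formal_Power_Series.fps_syntax

section \<open>Linear algebra in dimension 3\<close>

lemma module_hom_expansion_3:
  fixes g :: "'k::comm_ring_1 ^ 3 \<Rightarrow> 'b::ab_group_add"
  assumes "module_hom (*s) s g"
  shows "g x = s (x $ 1) (g (axis 1 1)) + s (x $ 2) (g (axis 2 1)) + s (x $ 3) (g (axis 3 1))"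
proof -
  have "g x = g (x $ 1 *s axis 1 1 + x $ 2 *s axis 2 1 + x $ 3 *s axis 3 1)"
    by (rule arg_cong[where f = g]) (simp add: vec_eq_iff forall_3 axis_def)
  then show ?thesis
    by (simp add: module_hom.add[OF assms] module_hom.scale[OF assms])
qed

text \<open>A totally isotropic subspace of a nondegenerate 3-space has dimension at most 3/2, hence
  is at most a line.\<close>

lemma isotropic_vectors_proportional_3:
  fixes B :: "'k::field ^ 3 \<Rightarrow> 'k ^ 3 \<Rightarrow> 'k"
  assumes bil: "bilinear_over (*) B"
    and nondeg: "\<And>x. (\<And>y. B x y = 0) \<Longrightarrow> x = 0"
    and iso: "B p p = 0" "B p w = 0" "B w p = 0" "B w w = 0"
    and "w \<noteq> 0"
  obtains c where "p = c *s w"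
proof -
  have homR: "module_hom (*s) (*) (B x)" and homL: "module_hom (*s) (*) (\<lambda>x. B x y)" for x y
    using bil by (auto simp: bilinear_over_def)
  define b where "b x = (\<chi> i. B x (axis i 1))" for x
  have B_b: "B x y = y $ 1 * b x $ 1 + y $ 2 * b x $ 2 + y $ 3 * b x $ 3" for x y
    using module_hom_expansion_3[OF homR, of x y] by (simp add: b_def)
  \<comment> \<open>The cross product \<open>p \<times> w\<close>; the covectors \<open>b p\<close> and \<open>b w\<close> annihilate \<open>p\<close> and \<open>w\<close>, so they are
    multiples of it.\<close>
  define m :: "'k ^ 3" where "m = vector [p $ 2 * w $ 3 - p $ 3 * w $ 2, p $ 3 * w $ 1 - p $ 1 * w $ 3,
      p $ 1 * w $ 2 - p $ 2 * w $ 1]"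
  have m: "m $ 1 = p $ 2 * w $ 3 - p $ 3 * w $ 2" "m $ 2 = p $ 3 * w $ 1 - p $ 1 * w $ 3"
    "m $ 3 = p $ 1 * w $ 2 - p $ 2 * w $ 1"
    by (simp_all add: m_def vector_def)
  obtain k where k: "w $ k \<noteq> 0"
    using \<open>w \<noteq> 0\<close> by (auto simp: vec_eq_iff)
  show thesis
  proof (cases "m = 0")
    case True
    then have *: "p $ i * w $ j = p $ j * w $ i" for i j
      using exhaust_3[of i] exhaust_3[of j] m by (auto simp: algebra_simps)
    have "p = (p $ k / w $ k) *s w"
      using k *[of _ k] by (simp add: vec_eq_iff field_simps)
    then show thesis ..
  next
    case False
    then obtain j where j: "m $ j \<noteq> 0"
      by (auto simp: vec_eq_iff)
    have par: "v $ i * m $ l = v $ l * m $ i"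
      if "p $ 1 * v $ 1 + p $ 2 * v $ 2 + p $ 3 * v $ 3 = 0"
        "w $ 1 * v $ 1 + w $ 2 * v $ 2 + w $ 3 * v $ 3 = 0" for v i l
    proof -
      have "v $ 1 * m $ 2 = v $ 2 * m $ 1" "v $ 1 * m $ 3 = v $ 3 * m $ 1" "v $ 2 * m $ 3 = v $ 3 * m $ 2"
        unfolding m using that by algebra+
      then show ?thesis
        using exhaust_3[of i] exhaust_3[of l] by auto
    qed
    have P: "b p $ i * m $ l = b p $ l * m $ i" and W: "b w $ i * m $ l = b w $ l * m $ i" for i l
      using iso by (auto intro!: par simp: B_b)
    \<comment> \<open>As both covectors are parallel to \<open>m\<close>, the combination
      \<open>b w $ j *s p - b p $ j *s w\<close> lies in the radical of \<open>B\<close>.\<close>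
    have "b w $ j * b p $ i = b p $ j * b w $ i" for i
    proof -
      have "(b w $ j * b p $ i) * m $ j = (b p $ j * b w $ i) * m $ j"
        using P[of i j] W[of i j] by algebra
      then show ?thesis
        using j by simp
    qed
    then have "b w $ j * B p y = b p $ j * B w y" for y
      unfolding B_b by (simp add: distrib_left mult.left_commute[of _ "y $ _"])
    then have "B (b w $ j *s p - b p $ j *s w) y = 0" for y
      by (simp add: module_hom.diff[OF homL] module_hom.scale[OF homL])
    then have "b w $ j *s p - b p $ j *s w = 0"
      by (rule nondeg)
    then have eq: "b w $ j *s p = b p $ j *s w"
      by simp
    have "b w $ j \<noteq> 0"
    proof
      assume "b w $ j = 0"
      then have "b w $ i = 0" for i
        using W[of i j] j by simp
      then have "B w y = 0" for y
        by (simp add: B_b)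
      then show False
        using nondeg \<open>w \<noteq> 0\<close> by blast
    qed
    then have "p = (b p $ j / b w $ j) *s w"
      using eq by (simp add: vec_eq_iff field_simps)
    then show thesis ..
  qed
qed

text \<open>An alternating 3-form that kills \<open>w\<close> descends to the quotient by
  \<open>w\<close>, which is only a plane.\<close>

lemma alternating_trilinear_3_eq_0:
  fixes f :: "'k::field ^ 3 \<Rightarrow> 'k ^ 3 \<Rightarrow> 'k ^ 3 \<Rightarrow> 'k"
  assumes hom: "\<And>y z. module_hom (*s) (*) (\<lambda>x. f x y z)"
    and cyclic: "\<And>x y z. f x y z = f y z x"
    and alt: "\<And>x z. f x x z = 0"
    and "w \<noteq> 0" "\<And>y z. f w y z = 0"
  shows "f x y z = 0"
proof -
  let ?e = "\<lambda>i. axis i 1 :: 'k ^ 3"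
  have alt': "f x y y = 0" "f x y x = 0" for x y
    using cyclic alt by metis+
  have add1: "f (x + x') y z = f x y z + f x' y z" for x x' y z
    by (rule module_hom.add[OF hom])
  have add2: "f x (y + y') z = f x y z + f x y' z" for x y y' z
    unfolding cyclic[of x] by (rule add1)
  have skew: "f x y z = - f y x z" for x y z
    using alt[of "x + y" z] unfolding add1 add2 by (simp add: alt eq_neg_iff_add_eq_0 add.commute)
  have ex: "f x y z = x $ 1 * f (?e 1) y z + x $ 2 * f (?e 2) y z + x $ 3 * f (?e 3) y z" for x y z
    by (rule module_hom_expansion_3[OF hom])
  \<comment> \<open>Expanding \<open>w\<close> against two basis vectors leaves one coordinate of
    \<open>w\<close> times the value on the basis; some coordinate is nonzero.\<close>
  have "w $ 1 * f (?e 1) (?e 2) (?e 3) = 0" "w $ 2 * f (?e 2) (?e 3) (?e 1) = 0"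
    "w $ 3 * f (?e 3) (?e 1) (?e 2) = 0"
    using ex[of w "?e 2" "?e 3"] ex[of w "?e 3" "?e 1"] ex[of w "?e 1" "?e 2"] assms(5)
    by (simp_all add: alt alt')
  moreover have "f (?e 2) (?e 3) (?e 1) = f (?e 1) (?e 2) (?e 3)"
    "f (?e 3) (?e 1) (?e 2) = f (?e 1) (?e 2) (?e 3)"
    by (metis cyclic)+
  ultimately have "f (?e 1) (?e 2) (?e 3) = 0"
    using \<open>w \<noteq> 0\<close> by (auto simp: vec_eq_iff forall_3)
  moreover from this have "f (?e 2) (?e 1) (?e 3) = 0"
    by (subst skew) simp
  ultimately have "f (?e i) (?e j) (?e k) = 0" for i j k
    using exhaust_3[of i] exhaust_3[of j] exhaust_3[of k]
      cyclic[of "?e 1" "?e 2" "?e 3"] cyclic[of "?e 2" "?e 3" "?e 1"]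
      cyclic[of "?e 2" "?e 1" "?e 3"] cyclic[of "?e 1" "?e 3" "?e 2"]
    by (elim disjE) (simp_all add: alt alt')
  \<comment> \<open>One slot is freed at a time: \<open>ex\<close> expands the first slot, then
    \<open>cyclic\<close> rotates a basis vector into it.\<close>
  then have "f x (?e j) (?e k) = 0" for x j k
    by (simp add: ex[of x])
  then have "f (?e k) x (?e j) = 0" for x j k
    by (metis cyclic)
  then have "f y x (?e j) = 0" for x y j
    by (simp add: ex[of y])
  then have "f (?e j) y x = 0" for x y j
    by (metis cyclic)
  then show ?thesis
    by (simp add: ex[of x])
qed

section \<open>Metric Leibniz algebras of dimension 3\<close>

text \<open>The form is \<open>h x = B w x / B w e\<close> with \<open>w = \<mu> e e\<close>. The
  base field is general so that the result serves both the complex numbers and Laurent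
  series.\<close>

lemma metric_leibniz_3_rank_one:
  fixes \<mu> :: "'k::field_char_0 ^ 3 \<Rightarrow> 'k ^ 3 \<Rightarrow> 'k ^ 3"
  assumes "metric_leibniz \<mu>" and w: "\<mu> e e \<noteq> 0"
  obtains h where "\<And>x y. \<mu> x y = (h x * h y) *s \<mu> e e" "h e = 1" "h (\<mu> e e) = 0"
proof -
  define w where "w = \<mu> e e"
  have "w \<noteq> 0"
    using w by (simp add: w_def)
  obtain B where bilB: "bilinear_over (*) B" and inv: "\<And>x y z. B (\<mu> x y) z = B x (\<mu> y z)"
    and sym: "\<And>x y. B x y = B y x" and nondeg: "\<And>x. (\<And>y. B x y = 0) \<Longrightarrow> x = 0"
    and bil: "bilinear_over (*s) \<mu>" and lb: "left_leibniz \<mu> \<or> right_leibniz \<mu>"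
    using assms(1) unfolding metric_leibniz_def invariant_form_def leibniz_algebra_def by metis
  have BR: "module_hom (*s) (*) (B x)" and BL: "module_hom (*s) (*) (\<lambda>x. B x y)" for x y
    using bilB by (auto simp: bilinear_over_def)
  have muR: "module_hom (*s) (*s) (\<mu> x)" and muL: "module_hom (*s) (*s) (\<lambda>x. \<mu> x y)" for x y
    using bil by (auto simp: bilinear_over_def)
  note lin = module_hom.add[OF BR] module_hom.add[OF BL] module_hom.add[OF muR] module_hom.add[OF muL]
    module_hom.scale[OF BR] module_hom.scale[OF BL] module_hom.scale[OF muR] module_hom.scale[OF muL]
    module_hom.zero[OF BR] module_hom.zero[OF BL] module_hom.diff[OF BR] module_hom.diff[OF BL]
    module_hom.diff[OF muR] module_hom.diff[OF muL]
  have cyc: "B (\<mu> x y) z = B (\<mu> y z) x" for x y z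
    unfolding inv[of x] by (rule sym)
  \<comment> \<open>The Leibniz identity with a repeated argument kills multiplication by a square
    on one side; invariance and nondegeneracy give the other side.\<close>
  have central: "\<mu> (\<mu> x x) y = 0" "\<mu> y (\<mu> x x) = 0" for x y
  proof -
    have "(\<forall>y. \<mu> (\<mu> x x) y = 0) \<or> (\<forall>y. \<mu> y (\<mu> x x) = 0)"
      using lb
    proof
      assume "left_leibniz \<mu>"
      then have "\<mu> x (\<mu> x y) = \<mu> (\<mu> x x) y + \<mu> x (\<mu> x y)" for y
        unfolding left_leibniz_def by blast
      then show ?thesis
        by simp
    next
      assume "right_leibniz \<mu>"
      then have "\<mu> y (\<mu> x x) = \<mu> (\<mu> y x) x - \<mu> (\<mu> y x) x" for y
        unfolding right_leibniz_def by blast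
      then show ?thesis
        by simp
    qed
    moreover have "\<mu> y (\<mu> x x) = 0" if "\<forall>y. \<mu> (\<mu> x x) y = 0" for y
    proof (rule nondeg)
      fix z
      show "B (\<mu> y (\<mu> x x)) z = 0"
        unfolding inv[of y "\<mu> x x"] using that by (simp add: lin)
    qed
    moreover have "\<mu> (\<mu> x x) y = 0" if "\<forall>y. \<mu> y (\<mu> x x) = 0" for y
    proof (rule nondeg)
      fix z
      show "B (\<mu> (\<mu> x x) y) z = 0"
        unfolding cyc[of "\<mu> x x"] inv[of y z] using that by (simp add: lin)
    qed
    ultimately show "\<mu> (\<mu> x x) y = 0" "\<mu> y (\<mu> x x) = 0"
      by blast+
  qed
  \<comment> \<open>By polarisation \<open>S x y\<close> is a combination of squares, hence central,
    hence orthogonal to every bracket.\<close>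
  define S where "S x y = \<mu> x y + \<mu> y x" for x y
  have S_eq: "S x y = \<mu> (x + y) (x + y) - \<mu> x x - \<mu> y y" for x y
    by (simp add: S_def lin)
  have S_central: "\<mu> (S x y) z = 0" for x y z
    unfolding S_eq module_hom.diff[OF muL] central by simp
  have S_perp: "B (S x y) (\<mu> u v) = 0" for x y u v
    unfolding inv[symmetric] S_central by (simp add: lin)
  have S_perp_S: "B (S x y) (S u v) = 0" for x y u v
    unfolding S_def[of u] using S_perp by (simp add: lin)
  have "\<exists>c. S x y = c *s w" for x y
  proof (rule isotropic_vectors_proportional_3[OF bilB nondeg])
    show "B (S x y) (S x y) = 0"
      by (rule S_perp_S)
    show "B (S x y) w = 0"
      unfolding w_def by (rule S_perp)
    then show "B w (S x y) = 0"
      by (simp only: sym[of w])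
    show "B w w = 0"
      unfolding w_def inv[symmetric] central by (simp add: lin)
  qed (use \<open>w \<noteq> 0\<close> in blast)+
  then obtain s where s: "\<And>x y. S x y = s x y *s w"
    by metis
  \<comment> \<open>Cyclicity passes to the symmetric part and, as \<open>S\<close> is valued in the
    line of \<open>w\<close>, ties \<open>s\<close> to the covector \<open>B w\<close>.\<close>
  have S_cyc: "B (S x y) z = B (S y z) x" for x y z
    using cyc[of x y z] cyc[of y x z] cyc[of x z y] by (simp add: S_def lin)
  then have s_cyc: "s x y * B w z = s y z * B w x" for x y z
    by (simp add: s lin)
  have s_ee: "s e e = 2"
  proof -
    have "s e e *s w = 2 *s w"
      using s[of e e] by (simp add: S_def w_def[symmetric] vec_eq_iff)
    then show ?thesis
      using \<open>w \<noteq> 0\<close> by simp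
  qed
  \<comment> \<open>Otherwise \<open>s_cyc\<close> at \<open>e\<close>, \<open>e\<close> puts
    \<open>w\<close> in the radical of \<open>B\<close>.\<close>
  have Bwe: "B w e \<noteq> 0"
  proof
    assume "B w e = 0"
    then have "2 * B w z = 0" for z
      using s_cyc[of e e z] s_ee by simp
    then have "B w z = 0" for z
      by simp
    then have "w = 0"
      by (rule nondeg)
    then show False
      using \<open>w \<noteq> 0\<close> by blast
  qed
  define h where "h x = B w x / B w e" for x
  have s_h: "s x y = 2 * (h x * h y)" for x y
  proof -
    have "s x y * B w e = s y e * B w x"
      by (rule s_cyc)
    moreover have "2 * B w y = s e y * B w e"
      unfolding s_ee[symmetric] by (rule s_cyc)
    moreover have "s e y * B w e = s y e * B w e"
      by (rule s_cyc)
    ultimately have "s x y * B w e * B w e = 2 * (B w x * B w y)"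
      by algebra
    then show ?thesis
      using Bwe by (simp add: h_def field_simps)
  qed
  have comm: "\<mu> x y = \<mu> y x" for x y
  proof -
    have "B (\<mu> x y - \<mu> y x) z = 0" for z
    \<comment> \<open>This form kills \<open>w\<close> because \<open>w\<close> is a square, hence
      central.\<close>
    proof (rule alternating_trilinear_3_eq_0[where f = "\<lambda>x y z. B (\<mu> x y - \<mu> y x) z" and w = w])
      show "module_hom (*s) (*) (\<lambda>x. B (\<mu> x y - \<mu> y x) z)" for y z
        using BL by (auto simp: module_hom_def module_hom_axioms_def lin algebra_simps)
      show "B (\<mu> x y - \<mu> y x) z = B (\<mu> y z - \<mu> z y) x" for x y z
        using cyc[of x y z] cyc[of z y x] by (simp add: lin)
    qed (use \<open>w \<noteq> 0\<close> central in \<open>simp_all add: lin w_def\<close>)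
    then have "\<mu> x y - \<mu> y x = 0"
      by (rule nondeg)
    then show ?thesis
      by simp
  qed
  show thesis
  proof
    fix x y
    have "2 *s \<mu> x y = 2 *s ((h x * h y) *s w)"
      using s[of x y] comm[of y x] by (simp add: S_def s_h vec_eq_iff algebra_simps)
    then show "\<mu> x y = (h x * h y) *s \<mu> e e"
      by (simp add: w_def[symmetric] vec_eq_iff mult.assoc)
    show "h e = 1"
      using Bwe by (simp add: h_def)
    show "h (\<mu> e e) = 0"
      using central(1)[of e e] by (simp add: h_def w_def inv[symmetric] lin)
  qed
qed

text \<open>The form \<open>h\<close> is eliminated so that the identities are polynomial in the structure constants: they
  can then be compared in powers of \<open>t\<close> and pulled back from \<open>\<complex>((t))\<close> to \<open>\<complex>[[t]]\<close>.\<close>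

lemma metric_leibniz_3_identities:
  fixes \<mu> :: "'k::field_char_0 ^ 3 \<Rightarrow> 'k ^ 3 \<Rightarrow> 'k ^ 3"
  assumes "metric_leibniz \<mu>" "\<mu> e e \<noteq> 0"
  shows "(\<mu> e e $ l)\<^sup>2 *s \<mu> x y = (\<mu> x e $ l * \<mu> y e $ l) *s \<mu> e e"
    and "\<mu> (\<mu> e e) e = 0"
proof -
  from assms obtain h where h: "\<And>x y. \<mu> x y = (h x * h y) *s \<mu> e e" "h e = 1" "h (\<mu> e e) = 0"
    by (rule metric_leibniz_3_rank_one) blast
  show "\<mu> (\<mu> e e) e = 0"
    using h(1)[of "\<mu> e e" e] h(3) by simp
  show "(\<mu> e e $ l)\<^sup>2 *s \<mu> x y = (\<mu> x e $ l * \<mu> y e $ l) *s \<mu> e e"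
    unfolding h(1)[of x y] h(1)[of x e] h(1)[of y e] h(2)
    by (simp add: vec_eq_iff power2_eq_square algebra_simps)
qed

section \<open>Metric cocycles: first-order comparison in t\<close>

text \<open>The factor \<open>[:0, 1, a:]\<close> vanishes exactly at the excluded parameters, so
  its product with \<open>p\<close> vanishes everywhere.\<close>

lemma poly_eq_0_if_cofinite_roots:
  fixes p :: "complex poly"
  assumes "\<And>t. t \<noteq> 0 \<Longrightarrow> 1 + t * a \<noteq> 0 \<Longrightarrow> poly p t = 0"
  shows "p = 0"
proof -
  have "poly (p * [:0, 1, a:]) t = 0" for t
    using assms[of t] unfolding poly_mult by auto
  then have "p * [:0, 1, a:] = 0"
    using poly_all_0_iff_0 by blast
  then show ?thesis
    unfolding mult_eq_0_iff by simp
qed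

text \<open>These are the coefficients of t in the two polynomial identities; the second is the
  compatibility that makes \<open>\<phi>\<close> a coboundary. The correction in \<open>q\<close>
  makes it vanish at \<open>axis 1 1\<close>.\<close>

lemma lambda2_metric_family_tangent:
  assumes bil: "bilinear_over (*s) \<phi>"
    and metric: "\<And>t. t \<noteq> 0 \<Longrightarrow> metric_leibniz (\<lambda>x y. lambda2 x y + t *s \<phi> x y)"
  defines "a \<equiv> \<phi> (axis 1 1) (axis 1 1)"
    and "q \<equiv> \<lambda>x. \<phi> x (axis 1 1) $ 3 - \<phi> (axis 1 1) (axis 1 1) $ 3 * x $ 1"
  shows "\<phi> x y = (x $ 1 * y $ 1) *s a + (x $ 1 * q y + q x * y $ 1) *s axis 3 1"
    and "q (axis 3 1) = - a $ 1"
proof -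
  let ?e = "axis 1 1 :: complex ^ 3"
  define \<mu> where "\<mu> t x y = lambda2 x y + t *s \<phi> x y" for t x y
  have homL: "module_hom (*s) (*s) (\<lambda>x. \<phi> x y)" for y
    using bil by (simp add: bilinear_over_def)
  have \<mu>_nth: "\<mu> t x y $ k = (x $ 1 * y $ 1) * axis 3 1 $ k + t * \<phi> x y $ k" for t x y k
    by (simp add: \<mu>_def lambda2_eq)
  have ax: "?e $ 1 = 1" "(axis 3 1 :: complex ^ 3) $ 3 = 1" "(axis 3 1 :: complex ^ 3) $ 1 = 0"
    by (simp_all add: axis_def)
  have ids: "(\<mu> t ?e ?e $ 3)\<^sup>2 *s \<mu> t x y = (\<mu> t x ?e $ 3 * \<mu> t y ?e $ 3) *s \<mu> t ?e ?e"
    "\<mu> t (\<mu> t ?e ?e) ?e = 0" if "t \<noteq> 0" "1 + t * a $ 3 \<noteq> 0" for t x y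
  proof -
    have "\<mu> t ?e ?e $ 3 \<noteq> 0"
      using that(2) by (simp add: \<mu>_nth ax a_def)
    then have "\<mu> t ?e ?e \<noteq> 0"
      by auto
    moreover have "metric_leibniz (\<mu> t)"
      using metric[OF that(1)] by (simp add: \<mu>_def[abs_def])
    ultimately show "(\<mu> t ?e ?e $ 3)\<^sup>2 *s \<mu> t x y = (\<mu> t x ?e $ 3 * \<mu> t y ?e $ 3) *s \<mu> t ?e ?e"
      "\<mu> t (\<mu> t ?e ?e) ?e = 0"
      by (intro metric_leibniz_3_identities; simp)+
  qed
  show "\<phi> x y = (x $ 1 * y $ 1) *s a + (x $ 1 * q y + q x * y $ 1) *s axis 3 1"
  proof (unfold vec_eq_iff, rule allI)
    fix k :: 3
    let ?d = "axis 3 1 $ k :: complex"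
    \<comment> \<open>Coordinate \<open>k\<close> of the difference of the two sides of the first
      identity, as a polynomial in t.\<close>
    let ?p = "[:1, a $ 3:] * [:1, a $ 3:] * [:x $ 1 * y $ 1 * ?d, \<phi> x y $ k:]
      - [:x $ 1, \<phi> x ?e $ 3:] * [:y $ 1, \<phi> y ?e $ 3:] * [:?d, a $ k:]"
    have "?p = 0"
    proof (rule poly_eq_0_if_cofinite_roots)
      fix t assume "t \<noteq> 0" "1 + t * a $ 3 \<noteq> 0"
      then have "((\<mu> t ?e ?e $ 3)\<^sup>2 *s \<mu> t x y) $ k
          = ((\<mu> t x ?e $ 3 * \<mu> t y ?e $ 3) *s \<mu> t ?e ?e) $ k"
        by (intro arg_cong[where f = "\<lambda>v. v $ k"] ids(1))
      then show "poly ?p t = 0"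
        unfolding poly_diff poly_mult poly_pCons poly_0
        by (simp add: \<mu>_nth ax a_def power2_eq_square)
    qed
    then have "coeff ?p 1 = 0"
      by (simp only: coeff_0)
    then show "\<phi> x y $ k = ((x $ 1 * y $ 1) *s a + (x $ 1 * q y + q x * y $ 1) *s axis 3 1) $ k"
      by (simp add: q_def a_def[symmetric] algebra_simps)
  qed
  \<comment> \<open>The third coordinate of \<open>\<mu> t (\<mu> t ?e ?e) ?e\<close>, as a
    polynomial in t.\<close>
  have "[:0, a $ 1 + \<phi> (axis 3 1) ?e $ 3, \<phi> a ?e $ 3:] = 0"
  proof (rule poly_eq_0_if_cofinite_roots)
    fix t assume "t \<noteq> 0" "1 + t * a $ 3 \<noteq> 0"
    then have "\<mu> t (\<mu> t ?e ?e) ?e $ 3 = 0"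
      by (simp add: ids(2))
    moreover have "\<mu> t ?e ?e = axis 3 1 + t *s a"
      by (simp add: \<mu>_def a_def lambda2_eq ax)
    ultimately show "poly [:0, a $ 1 + \<phi> (axis 3 1) ?e $ 3, \<phi> a ?e $ 3:] t = 0"
      by (simp add: \<mu>_nth ax module_hom.add[OF homL] module_hom.scale[OF homL] algebra_simps)
  qed
  then show "q (axis 3 1) = - a $ 1"
    by (simp add: q_def ax eq_neg_iff_add_eq_0 add.commute)
qed

lemma lambda2_no_metric_cocycle: "\<not> metric_leibniz_cocycle lambda2 \<phi>"
proof
  assume mc: "metric_leibniz_cocycle lambda2 \<phi>"
  then have cc: "cochain 2 (cochain2 \<phi>)"
    by (simp add: metric_leibniz_cocycle_def leibniz_cocycle_def)
  have homL: "module_hom (*s) (*s) (\<lambda>x. \<phi> x y)" and homR: "module_hom (*s) (*s) (\<phi> x)" for x y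
    using cc[unfolded cochain_def, rule_format, of "[x, y]" 0]
      cc[unfolded cochain_def, rule_format, of "[x, y]" 1]
    by (simp_all add: cochain2_def arg_def)
  have bil: "bilinear_over (*s) \<phi>"
    using homL homR by (simp add: bilinear_over_def)
  define a where "a = \<phi> (axis 1 1) (axis 1 1)"
  define q where "q x = \<phi> x (axis 1 1) $ 3 - a $ 3 * x $ 1" for x
  have metric: "metric_leibniz (\<lambda>x y. lambda2 x y + t *s \<phi> x y)" if "t \<noteq> 0" for t
    using mc that by (simp add: metric_leibniz_cocycle_def)
  have \<phi>_eq: "\<phi> x y = (x $ 1 * y $ 1) *s a + (x $ 1 * q y + q x * y $ 1) *s axis 3 1"
    and q3: "q (axis 3 1) = - a $ 1" for x y
    unfolding a_def q_def by (rule lambda2_metric_family_tangent[OF bil metric]; assumption)+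
  \<comment> \<open>The cochain with first coordinate \<open>q\<close> and \<open>G(e\<^sub>3) = - a\<close>, which are compatible by \<open>q3\<close>.\<close>
  define G where "G x = q x *s axis 1 1 - x $ 3 *s (a - a $ 1 *s axis 1 1)" for x
  have q_add: "q (x + y) = q x + q y" and q_scale: "q (c *s x) = c * q x" for x y c
    unfolding q_def module_hom.add[OF homL] module_hom.scale[OF homL] by (simp_all add: algebra_simps)
  have homG: "module_hom (*s) (*s) G"
    unfolding module_hom_def module_hom_axioms_def
    by (simp add: module_vec G_def q_add q_scale vec_eq_iff algebra_simps)
  then have "cochain 1 (\<lambda>xs. G (xs ! 0))"
    by (auto simp: cochain_def)
  moreover have "cochain2 \<phi> xs = leibniz_delta lambda2 1 (\<lambda>xs. G (xs ! 0)) xs" if "length xs = 2" for xs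
  proof -
    obtain x y where xs: "xs = [x, y]"
      using \<open>length xs = 2\<close> by (auto simp: numeral_2_eq_2 length_Suc_conv)
    have G1: "G v $ 1 = q v" for v
      by (simp add: G_def axis_def)
    have "G (lambda2 x y) = (x $ 1 * y $ 1) *s G (axis 3 1)"
      unfolding lambda2_eq by (rule module_hom.scale[OF homG])
    moreover have "G (axis 3 1) = - a"
      by (simp add: G_def q3)
    ultimately show ?thesis
      unfolding xs leibniz_delta_1
      by (simp add: cochain2_def arg_def \<phi>_eq lambda2_eq G1 vec_eq_iff algebra_simps)
  qed
  ultimately have "leibniz_coboundary lambda2 2 (cochain2 \<phi>)"
    unfolding leibniz_coboundary_def by (intro exI[of _ 1] exI[of _ "\<lambda>xs. G (xs ! 0)"]) auto
  then show False
    using mc by (simp add: metric_leibniz_cocycle_def)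
qed

section \<open>Formal deformations: from Laurent series back to power series\<close>

lemma bilinear_ext_axis: "bilinear_ext c (axis i 1) (axis j 1) = c i j"
proof -
  have "(axis i 1 $ k * axis j 1 $ l) *s c k l = (if l = j then if k = i then c i j else 0 else 0)"
    for k l
    by (auto simp: axis_def vec_eq_iff)
  then show ?thesis
    by (simp add: bilinear_ext_def)
qed

lemma bilinear_over_bilinear_ext: "bilinear_over (*s) (bilinear_ext c)"
  by (auto simp: bilinear_over_def module_hom_def module_hom_axioms_def module_vec bilinear_ext_def
      vec_eq_iff algebra_simps sum.distrib sum_distrib_left)

lemma fps_to_fls_sum: "fps_to_fls (sum f A) = (\<Sum>x\<in>A. fps_to_fls (f x))"
  by (induction A rule: infinite_finite_induct) auto

lemma vec_fps_to_fls_eq_iff: "vec_fps_to_fls x = vec_fps_to_fls y \<longleftrightarrow> x = y"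
  by (simp add: vec_fps_to_fls_def vec_eq_iff)

lemma vec_fps_to_fls_scale: "vec_fps_to_fls (c *s x) = fps_to_fls c *s vec_fps_to_fls x"
  by (simp add: vec_fps_to_fls_def vec_eq_iff fls_times_fps_to_fls)

lemma vec_fps_to_fls_0: "vec_fps_to_fls 0 = 0"
  by (simp add: vec_fps_to_fls_def vec_eq_iff)

text \<open>Both brackets have the same structure constants. Since the embedding is injective,
  identities proved over Laurent series descend along it.\<close>

lemma laurent_bracket_vec_fps_to_fls:
  "laurent_bracket \<phi> (vec_fps_to_fls x) (vec_fps_to_fls y) = vec_fps_to_fls (series_bracket \<phi> x y)"
  by (simp add: laurent_bracket_def series_bracket_def bilinear_ext_def vec_eq_iff
      vec_fps_to_fls_def fps_to_fls_sum fls_times_fps_to_fls)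

lemma metric_series_bracket_identities:
  fixes \<phi> :: "nat \<Rightarrow> complex ^ 3 \<Rightarrow> complex ^ 3 \<Rightarrow> complex ^ 3"
  assumes "metric_leibniz (laurent_bracket \<phi>)" "series_bracket \<phi> e e \<noteq> 0"
  shows "(series_bracket \<phi> e e $ l)\<^sup>2 *s series_bracket \<phi> x y
      = (series_bracket \<phi> x e $ l * series_bracket \<phi> y e $ l) *s series_bracket \<phi> e e"
    and "series_bracket \<phi> (series_bracket \<phi> e e) e = 0"
proof -
  let ?i = "vec_fps_to_fls :: complex fps ^ 3 \<Rightarrow> complex fls ^ 3"
  note br = laurent_bracket_vec_fps_to_fls
  have nz: "laurent_bracket \<phi> (?i e) (?i e) \<noteq> 0"
    using assms(2) by (metis br vec_fps_to_fls_0 vec_fps_to_fls_eq_iff)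
  have nth: "?i v $ k = fps_to_fls (v $ k)" for v k
    by (simp add: vec_fps_to_fls_def)
  have "?i ((series_bracket \<phi> e e $ l)\<^sup>2 *s series_bracket \<phi> x y)
      = ?i ((series_bracket \<phi> x e $ l * series_bracket \<phi> y e $ l) *s series_bracket \<phi> e e)"
    using metric_leibniz_3_identities(1)[OF assms(1) nz, of l "?i x" "?i y"]
    by (simp only: br nth vec_fps_to_fls_scale fps_to_fls_power fls_times_fps_to_fls)
  then show "(series_bracket \<phi> e e $ l)\<^sup>2 *s series_bracket \<phi> x y
      = (series_bracket \<phi> x e $ l * series_bracket \<phi> y e $ l) *s series_bracket \<phi> e e"
    by (simp only: vec_fps_to_fls_eq_iff)
  have "?i (series_bracket \<phi> (series_bracket \<phi> e e) e) = ?i 0"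
    using metric_leibniz_3_identities(2)[OF assms(1) nz] by (simp only: br vec_fps_to_fls_0)
  then show "series_bracket \<phi> (series_bracket \<phi> e e) e = 0"
    by (simp only: vec_fps_to_fls_eq_iff)
qed

lemma series_bracket_constant_lambda2:
  "series_bracket (constant_deformation lambda2) x y = (x $ 1 * y $ 1) *s axis 3 1"
proof -
  have "vec_series (\<lambda>m. constant_deformation lambda2 m (axis i 1) (axis j 1))
      = (if i = 1 \<and> j = 1 then axis 3 1 else 0)" for i j
    by (auto simp: vec_eq_iff vec_series_def constant_deformation_def lambda2_eq axis_def fps_eq_iff)
  then show ?thesis
    by (simp add: series_bracket_def bilinear_ext_def sum_3 vec_eq_iff)
qed

lemma lambda2_metric_deformation_trivial:
  assumes "formal_deformation lambda2 \<phi>" and metric: "metric_leibniz (laurent_bracket \<phi>)"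
  shows "trivial_deformation lambda2 \<phi>"
proof -
  let ?e = "\<lambda>i. axis i 1 :: complex fps ^ 3"
  define \<mu> where "\<mu> = series_bracket \<phi>"
  have \<phi>0: "\<phi> 0 = lambda2"
    using assms(1) by (simp add: formal_deformation_def)
  have \<mu>_const: "fps_nth (\<mu> (?e i) (?e j) $ k) 0 = lambda2 (axis i 1) (axis j 1) $ k" for i j k
    by (simp add: \<mu>_def series_bracket_def bilinear_ext_axis vec_series_def \<phi>0)
  have muL: "module_hom (*s) (*s) (\<lambda>x. \<mu> x y)" for y
    using bilinear_over_bilinear_ext by (auto simp: \<mu>_def series_bracket_def bilinear_over_def)
  define W where "W = \<mu> (?e 1) (?e 1)"
  have W_const: "fps_nth (W $ k) 0 = axis 3 1 $ k" for k
    unfolding W_def \<mu>_const lambda2_eq by (simp add: axis_def)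
  \<comment> \<open>\<open>W $ 3\<close> has constant term 1, so it is a unit among power series and
    \<open>h\<close> needs no Laurent denominators.\<close>
  define u where "u = inverse (W $ 3)"
  have u: "u * W $ 3 = 1"
    unfolding u_def by (rule inverse_mult_eq_1) (simp add: W_const axis_def)
  have "W \<noteq> 0"
    using u by auto
  define h where "h x = u * \<mu> x (?e 1) $ 3" for x
  have \<mu>_h: "\<mu> x y = (h x * h y) *s W" for x y
  proof -
    have "(W $ 3)\<^sup>2 *s \<mu> x y = (\<mu> x (?e 1) $ 3 * \<mu> y (?e 1) $ 3) *s W"
      using metric_series_bracket_identities(1)[OF metric] \<open>W \<noteq> 0\<close> by (simp add: W_def \<mu>_def)
    then have "(u * u) *s ((W $ 3)\<^sup>2 *s \<mu> x y) = (u * u) *s ((\<mu> x (?e 1) $ 3 * \<mu> y (?e 1) $ 3) *s W)"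
      by (rule arg_cong)
    moreover have "u * u * (W $ 3)\<^sup>2 = 1"
      using u by algebra
    ultimately show ?thesis
      by (simp add: h_def vector_smult_assoc mult_ac)
  qed
  have h_add: "h (x + y) = h x + h y" and h_diff: "h (x - y) = h x - h y"
    and h_scale: "h (c *s x) = c * h x" for x y c
    unfolding h_def module_hom.add[OF muL] module_hom.diff[OF muL] module_hom.scale[OF muL] by (simp_all add: algebra_simps)
  have h_ex: "h x = x $ 1 * h (?e 1) + x $ 2 * h (?e 2) + x $ 3 * h (?e 3)" for x
    unfolding h_def module_hom_expansion_3[OF muL, of x] by (simp add: algebra_simps)
  have h1: "h (?e 1) = 1"
    using u by (simp add: h_def W_def[symmetric])
  have "\<mu> W (?e 1) = 0"
    using metric_series_bracket_identities(2)[OF metric] \<open>W \<noteq> 0\<close> by (simp add: W_def \<mu>_def)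
  then have hW: "h W = 0"
    by (simp add: h_def)
  have "lambda2 (axis 2 1) (axis 1 1) = 0"
    by (simp add: lambda2_eq axis_def)
  \<comment> \<open>Needed for \<open>\<Phi> 0 = id\<close>: the image of the second basis vector
    must reduce to it at t = 0.\<close>
  then have h2_const: "fps_nth (h (?e 2)) 0 = 0"
    by (simp add: h_def \<mu>_const)
  \<comment> \<open>The images of the basis, on which \<open>h\<close> takes the values 1, 0, 0;
    \<open>\<Phi> m\<close> collects their coefficients of order \<open>m\<close>.\<close>
  define V where "V i = (if i = 1 then ?e 1 else if i = 2 then ?e 2 - h (?e 2) *s ?e 1 else W)"
    for i :: 3
  define \<Phi> where "\<Phi> m x = (\<chi> k. \<Sum>i\<in>UNIV. x $ i * fps_nth (V i $ k) m)" for m and x :: "complex ^ 3"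
  have "vec_series (\<lambda>m. \<Phi> m (axis i 1)) = V i" for i
    by (simp add: vec_eq_iff vec_series_def \<Phi>_def axis_def fps_eq_iff if_distrib[where f = "\<lambda>x. x * _"]
        cong: if_cong)
  then have F: "series_map \<Phi> x = x $ 1 *s ?e 1 + x $ 2 *s (?e 2 - h (?e 2) *s ?e 1) + x $ 3 *s W" for x
    by (simp add: series_map_def linear_ext_def sum_3 V_def)
  \<comment> \<open>The explicit inverse: \<open>h\<close> reads off the first coordinate,
    \<open>u\<close> undoes the factor \<open>W $ 3\<close>, and the second coordinate is corrected
    for the contribution of \<open>W\<close>.\<close>
  define G where "G y = h y *s ?e 1 + (y $ 2 - u * y $ 3 * W $ 2) *s ?e 2 + (u * y $ 3) *s ?e 3" for y
  have G_nth: "G y $ 1 = h y" "G y $ 2 = y $ 2 - u * y $ 3 * W $ 2" "G y $ 3 = u * y $ 3" for y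
    by (simp_all add: G_def axis_def)
  have F_nth: "series_map \<Phi> x $ 1 = x $ 1 - x $ 2 * h (?e 2) + x $ 3 * W $ 1"
    "series_map \<Phi> x $ 2 = x $ 2 + x $ 3 * W $ 2" "series_map \<Phi> x $ 3 = x $ 3 * W $ 3" for x
    by (simp_all add: F axis_def)
  have FG: "series_map \<Phi> (G y) = y" for y
  proof -
    have "W $ 1 + W $ 2 * h (?e 2) + W $ 3 * h (?e 3) = 0"
      using hW h_ex[of W] by (simp add: h1)
    moreover have "h y = y $ 1 + y $ 2 * h (?e 2) + y $ 3 * h (?e 3)"
      using h_ex[of y] by (simp add: h1)
    ultimately have "h y - (y $ 2 - u * y $ 3 * W $ 2) * h (?e 2) + u * y $ 3 * W $ 1 = y $ 1"
      using u by algebra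
    moreover have "u * y $ 3 * W $ 3 = y $ 3"
      using u by algebra
    ultimately show ?thesis
      by (simp add: vec_eq_iff forall_3 F_nth G_nth)
  qed
  have GF: "G (series_map \<Phi> x) = x" for x
  proof -
    have "h (series_map \<Phi> x) = x $ 1"
      by (simp add: F h_add h_diff h_scale hW h1)
    moreover have "u * (x $ 3 * W $ 3) = x $ 3"
      using u by algebra
    ultimately show ?thesis
      by (simp add: vec_eq_iff forall_3 G_nth F_nth(2,3))
  qed
  have inv: "inv (series_map \<Phi>) = G"
    by (rule inv_equality) (simp_all add: FG GF)
  show ?thesis
    unfolding trivial_deformation_def equivalent_deformations_def
  proof (intro exI[of _ \<Phi>] conjI allI)
    have "fps_nth (V i $ k) 0 = axis i 1 $ k" for i k
      using exhaust_3[of i] by (auto simp: V_def W_const h2_const) (auto simp: axis_def)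
    then show "\<Phi> 0 = id"
      by (simp add: \<Phi>_def fun_eq_iff vec_eq_iff axis_def if_distrib[where f = "\<lambda>x. _ * x"] cong: if_cong)
    show "module_hom (*s) (*s) (\<Phi> m)" for m
      by (simp add: module_hom_def module_hom_axioms_def module_vec \<Phi>_def vec_eq_iff sum_3 algebra_simps)
    show "series_bracket \<phi> x y = series_map \<Phi>
        (series_bracket (constant_deformation lambda2) (inv (series_map \<Phi>) x) (inv (series_map \<Phi>) y))"
      for x y
      \<comment> \<open>The constant bracket sees only the first coordinates \<open>h x\<close> and
        \<open>h y\<close>, and its value on the third axis is carried to a multiple of
        \<open>W\<close>.\<close>
      unfolding inv series_bracket_constant_lambda2 F
      by (simp add: G_nth axis_def \<mu>_h[unfolded \<mu>_def])
  qed
qed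

theorem proposition3p2:
  shows "\<not> (\<exists>\<phi>. metric_leibniz_cocycle lambda2 \<phi>) \<and> \<not> deforms_to_metric lambda2"
  using lambda2_no_metric_cocycle lambda2_metric_deformation_trivial
  unfolding deforms_to_metric_def by blast

end
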